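(* Let $\Gamma$ be an abelian group and $f:\Gamma\to\mathbb{C}$ a function with $f(0)=0$ and $\big(f(\alpha+\beta)-f(\alpha)-f(\beta)\big)\big(f(\alpha)-f(\beta)\big)=0$ for all $\alpha,\beta\in\Gamma$. Suppose $|f(\Gamma)|\ge 4$. Then the $\frac12$-derivations of $V(f)$ are exactly the linear maps $\varphi:V(f)\to V(f)$ of the form $$\varphi(e_\alpha)=\sum_{\gamma\in\Gamma} a_\gamma e_{\alpha+\gamma}\qquad(\alpha\in\Gamma),$$ where $\{a_\gamma\}_{\gamma\in\Gamma}\subseteq\mathbb{C}$ is a family having only a finite number of non-zero elements.
   Context: The Witt type Lie algebra $V(f)$ is the complex vector space with basis $\{e_\alpha\}_{\alpha\in\Gamma}$ and bracket $[e_\alpha,e_\beta]=(f(\beta)-f(\alpha))e_{\alpha+\beta}$. A $\frac12$-derivation of a Lie algebra $(L,[\cdot,\cdot])$ is a linear map $\varphi:L\to L$ with $\varphi([x,y])=\frac12\big([\varphi(x),y]+[x,\varphi(y)]\big)$ for all $x,y\in L$. *)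

theory Defs
  imports Complex_Main "HOL-Library.Poly_Mapping"
begin

locale lie_algebra = vector_space scale
  for scale :: "'k::field \<Rightarrow> 'v::ab_group_add \<Rightarrow> 'v" +
  fixes bracket :: "'v \<Rightarrow> 'v \<Rightarrow> 'v"
  assumes bracket_linear_left: "Vector_Spaces.linear scale scale (\<lambda>x. bracket x y)"
    and bracket_linear_right: "Vector_Spaces.linear scale scale (bracket x)"
    and bracket_self: "bracket x x = 0"
    and jacobi: "bracket x (bracket y z) + bracket y (bracket z x) + bracket z (bracket x y) = 0"

definition half_derivation ::
  "(complex \<Rightarrow> 'v \<Rightarrow> 'v) \<Rightarrow> ('v \<Rightarrow> 'v \<Rightarrow> 'v) \<Rightarrow> ('v::ab_group_add \<Rightarrow> 'v) \<Rightarrow> bool"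
  where "half_derivation scale bracket \<phi> \<longleftrightarrow>
    Vector_Spaces.linear scale scale \<phi> \<and>
    (\<forall>x y. \<phi> (bracket x y) = scale (1/2) (bracket (\<phi> x) y + bracket x (\<phi> y)))"

text \<open>
  The space underlying \<open>V(f)\<close> is the type of finitely supported functions
  \<open>'g \<Rightarrow>\<^sub>0 complex\<close>; the ring multiplication that the library puts on this type
  (the group algebra) plays no role in the definitions below.
\<close>

definition witt_scale :: "complex \<Rightarrow> ('g \<Rightarrow>\<^sub>0 complex) \<Rightarrow> ('g \<Rightarrow>\<^sub>0 complex)"
  where "witt_scale c = Poly_Mapping.map ((*) c)"

definition witt_basis :: "'g \<Rightarrow> ('g \<Rightarrow>\<^sub>0 complex)"
  where "witt_basis \<alpha> = Poly_Mapping.single \<alpha> 1"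

text \<open>The bilinear extension of \<open>[e\<^sub>\<alpha>, e\<^sub>\<beta>] = (f \<beta> - f \<alpha>) e\<^bsub>\<alpha>+\<beta>\<^esub>\<close>.\<close>

definition witt_bracket ::
  "('g::ab_group_add \<Rightarrow> complex) \<Rightarrow> ('g \<Rightarrow>\<^sub>0 complex) \<Rightarrow> ('g \<Rightarrow>\<^sub>0 complex) \<Rightarrow> ('g \<Rightarrow>\<^sub>0 complex)"
  where "witt_bracket f x y =
    (\<Sum>\<alpha>\<in>Poly_Mapping.keys x. \<Sum>\<beta>\<in>Poly_Mapping.keys y.
      witt_scale (Poly_Mapping.lookup x \<alpha> * Poly_Mapping.lookup y \<beta>)
        (witt_scale (f \<beta> - f \<alpha>) (witt_basis (\<alpha> + \<beta>))))"

lemma lookup_witt_scale [simp]: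
  "Poly_Mapping.lookup (witt_scale c x) \<alpha> = c * Poly_Mapping.lookup x \<alpha>"
  by (simp add: witt_scale_def Poly_Mapping.map.rep_eq when_def)

lemma vector_space_witt: "vector_space witt_scale"
  by unfold_locales (auto intro!: poly_mapping_eqI simp: lookup_add algebra_simps)

interpretation witt: vector_space witt_scale
  by (rule vector_space_witt)

lemma witt_expansion:
  "x = (\<Sum>\<alpha>\<in>Poly_Mapping.keys x. witt_scale (Poly_Mapping.lookup x \<alpha>) (witt_basis \<alpha>))"
proof (rule poly_mapping_eqI)
  fix k
  have "Poly_Mapping.lookup (\<Sum>\<alpha>\<in>Poly_Mapping.keys x. witt_scale (Poly_Mapping.lookup x \<alpha>) (witt_basis \<alpha>)) k
    = (\<Sum>\<alpha>\<in>Poly_Mapping.keys x. if \<alpha> = k then Poly_Mapping.lookup x k else 0)"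
    unfolding lookup_sum by (intro sum.cong refl) (auto simp: witt_basis_def lookup_single)
  also have "\<dots> = Poly_Mapping.lookup x k"
    by (simp add: in_keys_iff)
  finally show "Poly_Mapping.lookup x k =
    Poly_Mapping.lookup (\<Sum>\<alpha>\<in>Poly_Mapping.keys x. witt_scale (Poly_Mapping.lookup x \<alpha>) (witt_basis \<alpha>)) k" ..
qed

lemma inj_witt_basis: "inj witt_basis"
proof (rule injI)
  fix \<alpha> \<beta> :: 'a
  assume "(witt_basis \<alpha> :: 'a \<Rightarrow>\<^sub>0 complex) = witt_basis \<beta>"
  then have "Poly_Mapping.keys (witt_basis \<alpha>) = Poly_Mapping.keys (witt_basis \<beta>)"
    by simp
  then show "\<alpha> = \<beta>"
    by (simp add: witt_basis_def)
qed

lemma witt_basis_independent: "witt.independent (range (witt_basis :: 'g \<Rightarrow> 'g \<Rightarrow>\<^sub>0 complex))"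
proof
  assume "witt.dependent (range (witt_basis :: 'g \<Rightarrow> 'g \<Rightarrow>\<^sub>0 complex))"
  then have "\<exists>T u. finite T \<and> T \<subseteq> range (witt_basis :: 'g \<Rightarrow> 'g \<Rightarrow>\<^sub>0 complex) \<and>
      (\<exists>v\<in>T. u v \<noteq> 0) \<and> (\<Sum>v\<in>T. witt_scale (u v) v) = 0"
    unfolding witt.dependent_explicit by blast
  then obtain T u v where T: "finite T" "T \<subseteq> range (witt_basis :: 'g \<Rightarrow> 'g \<Rightarrow>\<^sub>0 complex)"
    and 0: "(\<Sum>v\<in>T. witt_scale (u v) v) = 0" and v: "v \<in> T" "u v \<noteq> 0"
    by blast
  from T v obtain \<alpha> where \<alpha>: "v = witt_basis \<alpha>" by blast
  have "u w * Poly_Mapping.lookup w \<alpha> = (if w = v then u v else 0)" if "w \<in> T" for w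
  proof -
    from that T obtain \<beta> where "w = witt_basis \<beta>" by blast
    then show ?thesis
      by (cases "\<beta> = \<alpha>") (simp_all add: \<alpha> inj_eq[OF inj_witt_basis], simp_all add: witt_basis_def lookup_single)
  qed
  then have "(\<Sum>w\<in>T. u w * Poly_Mapping.lookup w \<alpha>) = u v"
    using T(1) v(1) by simp
  moreover have "Poly_Mapping.lookup (\<Sum>w\<in>T. witt_scale (u w) w) \<alpha> =
      (\<Sum>w\<in>T. u w * Poly_Mapping.lookup w \<alpha>)"
    by (simp add: lookup_sum)
  ultimately show False
    using 0 v(2) by simp
qed

lemma witt_basis_span: "witt.span (range witt_basis) = UNIV"
proof -
  have "x \<in> witt.span (range witt_basis)" for x :: "'a \<Rightarrow>\<^sub>0 complex"
    by (subst witt_expansion) (intro witt.span_sum witt.span_scale witt.span_base rangeI)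
  then show ?thesis by blast
qed

lemma witt_bracket_superset:
  assumes "finite A" "finite B" "Poly_Mapping.keys x \<subseteq> A" "Poly_Mapping.keys y \<subseteq> B"
  shows "witt_bracket f x y =
    (\<Sum>\<alpha>\<in>A. \<Sum>\<beta>\<in>B.
      witt_scale (Poly_Mapping.lookup x \<alpha> * Poly_Mapping.lookup y \<beta> * (f \<beta> - f \<alpha>)) (witt_basis (\<alpha> + \<beta>)))"
  unfolding witt_bracket_def using assms
  by (intro sum.mono_neutral_cong_left) (auto intro!: sum.mono_neutral_cong_left sum.neutral simp: in_keys_iff)

lemma witt_bracket_basis:
  "witt_bracket f (witt_basis \<alpha>) (witt_basis \<beta>) = witt_scale (f \<beta> - f \<alpha>) (witt_basis (\<alpha> + \<beta>))"
  by (simp add: witt_bracket_def witt_basis_def)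

lemma witt_bracket_linear_left:
  "Vector_Spaces.linear witt_scale witt_scale (\<lambda>x. witt_bracket f x y)"
proof (unfold Vector_Spaces.linear_iff, intro conjI allI)
  fix x z :: "'a \<Rightarrow>\<^sub>0 complex"
  let ?A = "Poly_Mapping.keys x \<union> Poly_Mapping.keys z"
  have "Poly_Mapping.keys (x + z) \<subseteq> ?A" by (rule Poly_Mapping.keys_add)
  then show "witt_bracket f (x + z) y = witt_bracket f x y + witt_bracket f z y"
    by (simp add: witt_bracket_superset[of ?A "Poly_Mapping.keys y"] lookup_add
        witt.scale_left_distrib distrib_right sum.distrib)
next
  fix c and x :: "'a \<Rightarrow>\<^sub>0 complex"
  let ?A = "Poly_Mapping.keys x"
  have "Poly_Mapping.keys (witt_scale c x) \<subseteq> ?A" by (auto simp: in_keys_iff)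
  then show "witt_bracket f (witt_scale c x) y = witt_scale c (witt_bracket f x y)"
    by (simp add: witt_bracket_superset[of ?A "Poly_Mapping.keys y"] witt.scale_sum_right mult.assoc)
qed (rule vector_space_witt)+

lemma witt_bracket_swap: "witt_bracket f y x = - witt_bracket f x y"
proof -
  have "witt_bracket f y x = (\<Sum>\<alpha>\<in>Poly_Mapping.keys x. \<Sum>\<beta>\<in>Poly_Mapping.keys y.
      witt_scale (Poly_Mapping.lookup y \<beta> * Poly_Mapping.lookup x \<alpha> * (f \<alpha> - f \<beta>)) (witt_basis (\<beta> + \<alpha>)))"
    unfolding witt_bracket_def by (subst sum.swap) simp
  also have "\<dots> = - witt_bracket f x y"
    unfolding witt_bracket_def sum_negf[symmetric]
    by (intro sum.cong refl) (simp add: witt.scale_minus_left[symmetric] algebra_simps del: witt.scale_minus_left)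
  finally show ?thesis .
qed

lemma witt_bracket_linear_right:
  "Vector_Spaces.linear witt_scale witt_scale (witt_bracket f x)"
proof -
  interpret l: Vector_Spaces.linear witt_scale witt_scale "\<lambda>y. witt_bracket f y x"
    by (rule witt_bracket_linear_left)
  have "witt_bracket f x = (\<lambda>y. - witt_bracket f y x)"
    by (auto simp: witt_bracket_swap[of f x])
  then show ?thesis
    by (auto simp: Vector_Spaces.linear_iff vector_space_witt l.add l.scale)
qed

lemma witt_induct [case_names basis add scale]:
  assumes "\<And>\<alpha>. P (witt_basis \<alpha>)" "\<And>x y. P x \<Longrightarrow> P y \<Longrightarrow> P (x + y)" "\<And>c x. P x \<Longrightarrow> P (witt_scale c x)"
  shows "P x"
proof -
  have "P 0" using assms(3)[OF assms(1), of 0] by simp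
  then have "P (\<Sum>\<alpha>\<in>A. witt_scale (Poly_Mapping.lookup x \<alpha>) (witt_basis \<alpha>))" for A
    by (induction A rule: infinite_finite_induct) (auto intro: assms)
  then show ?thesis by (subst witt_expansion)
qed

lemma lie_algebra_witt:
  fixes f :: "'g::ab_group_add \<Rightarrow> complex"
  assumes f: "\<And>\<alpha> \<beta>. (f (\<alpha> + \<beta>) - f \<alpha> - f \<beta>) * (f \<alpha> - f \<beta>) = 0"
  shows "lie_algebra witt_scale (witt_bracket f)"
proof -
  note lin = witt_bracket_linear_left witt_bracket_linear_right
  have bracket_add: "witt_bracket f (x + z) y = witt_bracket f x y + witt_bracket f z y"
    "witt_bracket f y (x + z) = witt_bracket f y x + witt_bracket f y z"
    and bracket_scale: "witt_bracket f (witt_scale c x) y = witt_scale c (witt_bracket f x y)"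
    "witt_bracket f y (witt_scale c x) = witt_scale c (witt_bracket f y x)" for c x y z
    using lin[of f] by (auto simp: Vector_Spaces.linear_iff)
  let ?J = "\<lambda>x y z. witt_bracket f x (witt_bracket f y z) + witt_bracket f y (witt_bracket f z x)
    + witt_bracket f z (witt_bracket f x y)"
  have J0: "?J (witt_basis \<alpha>) (witt_basis \<beta>) (witt_basis \<gamma>) = 0" for \<alpha> \<beta> \<gamma>
  proof -
    have perm: "\<beta> + (\<gamma> + \<alpha>) = \<alpha> + (\<beta> + \<gamma>)" "\<gamma> + (\<alpha> + \<beta>) = \<alpha> + (\<beta> + \<gamma>)"
      by (simp_all add: algebra_simps)
    have *: "(f v - f u) * f (u + v) = (f v - f u) * (f u + f v)" for u v
      using f[of u v] by (auto simp: diff_diff_eq)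
    have "(f \<gamma> - f \<beta>) * (f (\<beta> + \<gamma>) - f \<alpha>) + (f \<alpha> - f \<gamma>) * (f (\<gamma> + \<alpha>) - f \<beta>)
      + (f \<beta> - f \<alpha>) * (f (\<alpha> + \<beta>) - f \<gamma>) = 0"
      by (simp only: right_diff_distrib[of _ "f (_ + _)"] *) (simp add: algebra_simps)
    then show ?thesis
      by (simp only: witt_bracket_basis bracket_scale witt.scale_scale perm
          witt.scale_left_distrib[symmetric] witt.scale_zero_left)
  qed
  have J1: "?J (witt_basis \<alpha>) (witt_basis \<beta>) z = 0" for \<alpha> \<beta> z
  proof (induction z rule: witt_induct)
    case (add u v)
    have "?J (witt_basis \<alpha>) (witt_basis \<beta>) (u + v) =
        ?J (witt_basis \<alpha>) (witt_basis \<beta>) u + ?J (witt_basis \<alpha>) (witt_basis \<beta>) v"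
      by (simp only: bracket_add ac_simps)
    with add.IH show ?case by simp
  next
    case (scale c u)
    have "?J (witt_basis \<alpha>) (witt_basis \<beta>) (witt_scale c u) = witt_scale c (?J (witt_basis \<alpha>) (witt_basis \<beta>) u)"
      by (simp only: bracket_scale witt.scale_right_distrib)
    with scale.IH show ?case by simp
  qed (rule J0)
  have J2: "?J (witt_basis \<alpha>) y z = 0" for \<alpha> y z
  proof (induction y rule: witt_induct)
    case (add u v)
    have "?J (witt_basis \<alpha>) (u + v) z = ?J (witt_basis \<alpha>) u z + ?J (witt_basis \<alpha>) v z"
      by (simp only: bracket_add ac_simps)
    with add.IH show ?case by simp
  next
    case (scale c u)
    have "?J (witt_basis \<alpha>) (witt_scale c u) z = witt_scale c (?J (witt_basis \<alpha>) u z)"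
      by (simp only: bracket_scale witt.scale_right_distrib)
    with scale.IH show ?case by simp
  qed (rule J1)
  have J3: "?J x y z = 0" for x y z
  proof (induction x rule: witt_induct)
    case (add u v)
    have "?J (u + v) y z = ?J u y z + ?J v y z"
      by (simp only: bracket_add ac_simps)
    with add.IH show ?case by simp
  next
    case (scale c u)
    have "?J (witt_scale c u) y z = witt_scale c (?J u y z)"
      by (simp only: bracket_scale witt.scale_right_distrib)
    with scale.IH show ?case by simp
  qed (rule J2)
  have self: "witt_bracket f x x = 0" for x
  proof (rule poly_mapping_eqI)
    fix \<alpha>
    define c where "c = Poly_Mapping.lookup (witt_bracket f x x) \<alpha>"
    have "c = - c"
      unfolding c_def by (metis witt_bracket_swap lookup_uminus)
    then have "2 * c = 0"
      by (metis add.right_inverse mult_2)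
    then show "Poly_Mapping.lookup (witt_bracket f x x) \<alpha> = Poly_Mapping.lookup 0 \<alpha>"
      by (simp add: c_def)
  qed
  show ?thesis
    by (intro lie_algebra.intro vector_space_witt lie_algebra_axioms.intro lin self J3)
qed

end

theory Submission
  imports Defs
begin

text \<open>
  Four values of \<open>f\<close> force \<open>f\<close> to be additive (\<open>additive_if_four_values\<close>): the hypothesis only
  leaves \<open>f (\<alpha> + \<beta>)\<close> undetermined when \<open>f \<alpha> = f \<beta>\<close>, and then adding an auxiliary element whose
  value avoids three forbidden ones moves every sum that occurs into the determined case.

  For additive \<open>f\<close> the algebra is graded by \<open>\<Gamma>\<close>, and so the condition on a linear map \<open>\<phi>\<close> splits
  into independent conditions on its homogeneous components. Writing
  \<open>\<phi> (e\<^sub>\<alpha>) = \<Sum>\<^sub>\<gamma> c \<alpha> \<gamma> e\<^bsub>\<alpha>+\<gamma>\<^esub>\<close>, the map is a half-derivation iff, for all \<open>\<alpha>\<close>, \<open>\<beta>\<close>, \<open>\<gamma>\<close>,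
  \<open>2 (f \<beta> - f \<alpha>) c (\<alpha> + \<beta>) \<gamma> = (f \<beta> - f \<alpha> - f \<gamma>) c \<alpha> \<gamma> + (f \<beta> + f \<gamma> - f \<alpha>) c \<beta> \<gamma>\<close>
  (\<open>half_derivation_iff_coeff\<close>). If \<open>c\<close> does not depend on \<open>\<alpha>\<close>, the two sides agree identically.
  Conversely, \<open>\<beta> = 0\<close> gives \<open>c \<alpha> \<gamma> = c 0 \<gamma>\<close> whenever \<open>f \<alpha> \<noteq> f \<gamma>\<close>, and the exceptional \<open>\<alpha>\<close> are
  reached by pairing them with a \<open>\<beta>\<close> whose value again avoids three others
  (\<open>coeff_constant\<close>). Hence the family is \<open>a \<gamma> = c 0 \<gamma>\<close>, which has finite support because it lists the
  coordinates of \<open>\<phi> (e\<^sub>0)\<close>.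
\<close>

lemma avoid_three_values:
  assumes "infinite (range f) \<or> card (range f) \<ge> 4"
  obtains \<gamma> where "f \<gamma> \<noteq> x" "f \<gamma> \<noteq> y" "f \<gamma> \<noteq> z"
proof -
  have "card {x, y, z} \<le> 3"
    by (simp add: card_insert_if)
  then have "\<not> range f \<subseteq> {x, y, z}"
    using assms card_mono[of "{x, y, z}" "range f"] finite_subset[of "range f" "{x, y, z}"] by force
  then show thesis
    using that by blast
qed

text \<open>
  With \<open>f \<alpha> = f \<beta>\<close> and \<open>f \<gamma>\<close> different from \<open>0\<close>, \<open>f \<beta>\<close> and \<open>f (\<alpha> + \<beta>)\<close>, the value at
  \<open>\<alpha> + \<beta> + \<gamma>\<close> is \<open>f \<alpha> + (f \<beta> + f \<gamma>)\<close> for one bracketing and \<open>f (\<alpha> + \<beta>) + f \<gamma>\<close> for the other.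
\<close>

lemma additive_if_four_values:
  fixes f :: "'g::ab_group_add \<Rightarrow> complex"
  assumes f: "\<And>\<alpha> \<beta>. (f (\<alpha> + \<beta>) - f \<alpha> - f \<beta>) * (f \<alpha> - f \<beta>) = 0"
    and four: "infinite (range f) \<or> card (range f) \<ge> 4"
  shows "f (\<alpha> + \<beta>) = f \<alpha> + f \<beta>"
proof (cases "f \<alpha> = f \<beta>")
  case True
  have add: "f (u + v) = f u + f v" if "f u \<noteq> f v" for u v
    using f[of u v] that by (simp add: diff_diff_eq)
  obtain \<gamma> where \<gamma>: "f \<gamma> \<noteq> 0" "f \<gamma> \<noteq> f \<beta>" "f \<gamma> \<noteq> f (\<alpha> + \<beta>)"
    using avoid_three_values[OF four] .
  have "f (\<alpha> + \<beta>) + f \<gamma> = f (\<alpha> + (\<beta> + \<gamma>))"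
    using add[of "\<alpha> + \<beta>" \<gamma>] \<gamma> by (simp add: add.assoc)
  also have "\<dots> = f \<alpha> + (f \<beta> + f \<gamma>)"
    using add[of \<beta> \<gamma>] add[of \<alpha> "\<beta> + \<gamma>"] \<gamma> True by simp
  finally show ?thesis
    by simp
next
  case False
  then show ?thesis
    using f[of \<alpha> \<beta>] by (simp add: diff_diff_eq)
qed

lemma lookup_witt_basis:
  "Poly_Mapping.lookup (witt_basis \<alpha>) \<beta> = (if \<alpha> = \<beta> then 1 else 0)"
  by (simp add: witt_basis_def lookup_single when_def)

lemma witt_bracket_add_left: "witt_bracket f (x + z) y = witt_bracket f x y + witt_bracket f z y"
  and witt_bracket_scale_left: "witt_bracket f (witt_scale c x) y = witt_scale c (witt_bracket f x y)"
  using witt_bracket_linear_left[of f y] by (auto simp: Vector_Spaces.linear_iff)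

lemma witt_bracket_add_right: "witt_bracket f y (x + z) = witt_bracket f y x + witt_bracket f y z"
  and witt_bracket_scale_right: "witt_bracket f y (witt_scale c x) = witt_scale c (witt_bracket f y x)"
  using witt_bracket_linear_right[of f y] by (auto simp: Vector_Spaces.linear_iff)

lemma lookup_witt_bracket_basis_right:
  "Poly_Mapping.lookup (witt_bracket f x (witt_basis \<beta>)) \<delta> =
    (f \<beta> - f (\<delta> - \<beta>)) * Poly_Mapping.lookup x (\<delta> - \<beta>)"
proof (induction x rule: witt_induct)
  case (basis \<alpha>)
  have "\<alpha> + \<beta> = \<delta> \<longleftrightarrow> \<alpha> = \<delta> - \<beta>"
    by (auto simp: algebra_simps)
  then show ?case
    by (simp add: witt_bracket_basis lookup_witt_basis)
qed (simp_all add: witt_bracket_add_left witt_bracket_scale_left lookup_add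
    distrib_left mult.left_commute)

lemma lookup_witt_bracket_basis_left:
  "Poly_Mapping.lookup (witt_bracket f (witt_basis \<alpha>) y) \<delta> =
    (f (\<delta> - \<alpha>) - f \<alpha>) * Poly_Mapping.lookup y (\<delta> - \<alpha>)"
  unfolding witt_bracket_swap[of f "witt_basis \<alpha>" y] lookup_uminus lookup_witt_bracket_basis_right
  by (simp add: algebra_simps)

lemma half_derivation_iff_basis:
  "half_derivation witt_scale (witt_bracket f) \<phi> \<longleftrightarrow>
    Vector_Spaces.linear witt_scale witt_scale \<phi> \<and>
    (\<forall>\<alpha> \<beta>. \<phi> (witt_bracket f (witt_basis \<alpha>) (witt_basis \<beta>)) =
      witt_scale (1/2) (witt_bracket f (\<phi> (witt_basis \<alpha>)) (witt_basis \<beta>) +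
        witt_bracket f (witt_basis \<alpha>) (\<phi> (witt_basis \<beta>))))"
proof -
  define D where "D x y \<longleftrightarrow> \<phi> (witt_bracket f x y) =
    witt_scale (1/2) (witt_bracket f (\<phi> x) y + witt_bracket f x (\<phi> y))" for x y
  have "D x y" if lin: "Vector_Spaces.linear witt_scale witt_scale \<phi>"
    and D: "\<And>\<alpha> \<beta>. D (witt_basis \<alpha>) (witt_basis \<beta>)" for x y
  proof -
    have \<phi>: "\<phi> (u + v) = \<phi> u + \<phi> v" "\<phi> (witt_scale c u) = witt_scale c (\<phi> u)" for u v c
      using lin by (auto simp: Vector_Spaces.linear_iff)
    note bilinear = \<phi> witt_bracket_add_left witt_bracket_scale_left
      witt_bracket_add_right witt_bracket_scale_right witt.scale_right_distrib
    have "D (witt_basis \<alpha>) y" for \<alpha>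
    proof (induction y rule: witt_induct)
      case (scale c u)
      then show ?case
        unfolding D_def by (simp add: bilinear mult.commute)
    qed (use D in \<open>simp_all add: D_def bilinear algebra_simps\<close>)
    then show ?thesis
    proof (induction x rule: witt_induct)
      case (scale c u)
      then show ?case
        unfolding D_def by (simp add: bilinear mult.commute)
    qed (simp_all add: D_def bilinear algebra_simps)
  qed
  then show ?thesis
    unfolding half_derivation_def D_def by blast
qed

text \<open>
  The coefficient \<open>c \<alpha> \<gamma>\<close> of the overview is the coordinate of \<open>\<phi> (e\<^sub>\<alpha>)\<close> at \<open>\<alpha> + \<gamma>\<close>. For fixed \<open>\<alpha>\<close>,
  \<open>\<beta>\<close> every index has the form \<open>\<alpha> + \<beta> + \<gamma>\<close>, and comparing coordinates there keeps \<open>\<gamma>\<close> the same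
  in all three terms.
\<close>

lemma half_derivation_iff_coeff:
  fixes f :: "'g::ab_group_add \<Rightarrow> complex"
  assumes add: "\<And>\<alpha> \<beta>. f (\<alpha> + \<beta>) = f \<alpha> + f \<beta>"
    and lin: "Vector_Spaces.linear witt_scale witt_scale \<phi>"
    and c: "\<And>\<alpha> \<gamma>. c \<alpha> \<gamma> = Poly_Mapping.lookup (\<phi> (witt_basis \<alpha>)) (\<alpha> + \<gamma>)"
  shows "half_derivation witt_scale (witt_bracket f) \<phi> \<longleftrightarrow>
    (\<forall>\<alpha> \<beta> \<gamma>. 2 * (f \<beta> - f \<alpha>) * c (\<alpha> + \<beta>) \<gamma> =
      (f \<beta> - f \<alpha> - f \<gamma>) * c \<alpha> \<gamma> + (f \<beta> + f \<gamma> - f \<alpha>) * c \<beta> \<gamma>)"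
proof -
  have \<phi>: "\<phi> (witt_scale r u) = witt_scale r (\<phi> u)" for u r
    using lin by (auto simp: Vector_Spaces.linear_iff)
  have "\<phi> (witt_bracket f (witt_basis \<alpha>) (witt_basis \<beta>)) =
      witt_scale (1/2) (witt_bracket f (\<phi> (witt_basis \<alpha>)) (witt_basis \<beta>) +
        witt_bracket f (witt_basis \<alpha>) (\<phi> (witt_basis \<beta>))) \<longleftrightarrow>
    (\<forall>\<gamma>. 2 * (f \<beta> - f \<alpha>) * c (\<alpha> + \<beta>) \<gamma> =
      (f \<beta> - f \<alpha> - f \<gamma>) * c \<alpha> \<gamma> + (f \<beta> + f \<gamma> - f \<alpha>) * c \<beta> \<gamma>)"
    (is "?x = ?y \<longleftrightarrow> _") for \<alpha> \<beta>
  proof -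
    have "?x = ?y \<longleftrightarrow>
        (\<forall>\<gamma>. Poly_Mapping.lookup ?x (\<alpha> + \<beta> + \<gamma>) = Poly_Mapping.lookup ?y (\<alpha> + \<beta> + \<gamma>))"
    proof
      assume eq: "\<forall>\<gamma>. Poly_Mapping.lookup ?x (\<alpha> + \<beta> + \<gamma>) = Poly_Mapping.lookup ?y (\<alpha> + \<beta> + \<gamma>)"
      show "?x = ?y"
      proof (rule poly_mapping_eqI)
        fix \<delta>
        show "Poly_Mapping.lookup ?x \<delta> = Poly_Mapping.lookup ?y \<delta>"
          using spec[OF eq, of "\<delta> - (\<alpha> + \<beta>)"] by simp
      qed
    qed simp
    moreover have "Poly_Mapping.lookup ?x (\<alpha> + \<beta> + \<gamma>) = (f \<beta> - f \<alpha>) * c (\<alpha> + \<beta>) \<gamma>" for \<gamma>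
      by (simp add: witt_bracket_basis \<phi> c)
    moreover have "Poly_Mapping.lookup ?y (\<alpha> + \<beta> + \<gamma>) =
      ((f \<beta> - f \<alpha> - f \<gamma>) * c \<alpha> \<gamma> + (f \<beta> + f \<gamma> - f \<alpha>) * c \<beta> \<gamma>) / 2" for \<gamma>
    proof -
      have "\<alpha> + \<beta> + \<gamma> - \<beta> = \<alpha> + \<gamma>" "\<alpha> + \<beta> + \<gamma> - \<alpha> = \<beta> + \<gamma>"
        by (simp_all add: algebra_simps)
      then show ?thesis
        by (simp add: lookup_witt_bracket_basis_right lookup_witt_bracket_basis_left lookup_add
            add c diff_diff_eq)
    qed
    moreover have "r = s / 2 \<longleftrightarrow> 2 * r = s" for r s :: complex
      by auto
    ultimately show ?thesis
      by (simp only: mult.assoc)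
  qed
  then show ?thesis
    unfolding half_derivation_iff_basis using lin by simp
qed

text \<open>
  The equation is the one for a homogeneous component of degree \<open>\<gamma>\<close>, with \<open>g = f \<gamma>\<close>. At \<open>\<beta> = 0\<close> it reads
  \<open>(f \<alpha> - g) c \<alpha> = (f \<alpha> - g) c 0\<close>. If \<open>f \<alpha> = g\<close>, choose \<open>\<beta>\<close> with \<open>f \<beta>\<close> outside \<open>{0, g, 2 g}\<close>: the
  first two exclusions make both \<open>c (\<alpha> + \<beta>)\<close> and \<open>c \<beta>\<close> equal to \<open>c 0\<close>, and the third makes the
  factor \<open>f \<beta> - 2 g\<close> of \<open>c \<alpha>\<close> invertible.
\<close>

lemma coeff_constant:
  fixes f :: "'g::ab_group_add \<Rightarrow> complex"
  assumes add: "\<And>\<alpha> \<beta>. f (\<alpha> + \<beta>) = f \<alpha> + f \<beta>"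
    and four: "infinite (range f) \<or> card (range f) \<ge> 4"
    and eq: "\<And>\<alpha> \<beta>. 2 * (f \<beta> - f \<alpha>) * c (\<alpha> + \<beta>) = (f \<beta> - f \<alpha> - g) * c \<alpha> + (f \<beta> + g - f \<alpha>) * c \<beta>"
  shows "c \<alpha> = c 0"
proof -
  have "f 0 = 0"
    using add[of 0 0] by simp
  have generic: "c \<beta> = c 0" if "f \<beta> \<noteq> g" for \<beta>
  proof -
    have "(f \<beta> - g) * (c \<beta> - c 0) = 0"
      using eq[of 0 \<beta>] \<open>f 0 = 0\<close> by (simp add: algebra_simps)
    with that show ?thesis
      by simp
  qed
  show ?thesis
  proof (cases "f \<alpha> = g")
    case True
    obtain \<beta> where \<beta>: "f \<beta> \<noteq> 0" "f \<beta> \<noteq> g" "f \<beta> \<noteq> 2 * g"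
      using avoid_three_values[OF four] .
    have "c (\<alpha> + \<beta>) = c 0" "c \<beta> = c 0"
      using \<beta> True by (simp_all add: generic add)
    then have "(f \<beta> - 2 * g) * (c \<alpha> - c 0) = 0"
      using eq[of \<beta> \<alpha>] True by (simp add: algebra_simps)
    with \<beta> show ?thesis
      by simp
  qed (rule generic)
qed

lemma shifted_sum_iff_lookup:
  fixes a :: "'g::ab_group_add \<Rightarrow> complex"
  assumes "finite {\<gamma>. a \<gamma> \<noteq> 0}"
  shows "x = (\<Sum>\<gamma> | a \<gamma> \<noteq> 0. witt_scale (a \<gamma>) (witt_basis (\<alpha> + \<gamma>))) \<longleftrightarrow>
    (\<forall>\<gamma>. Poly_Mapping.lookup x (\<alpha> + \<gamma>) = a \<gamma>)" (is "x = ?s \<longleftrightarrow> _")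
proof -
  have s: "Poly_Mapping.lookup ?s (\<alpha> + \<gamma>) = a \<gamma>" for \<gamma>
  proof -
    have "Poly_Mapping.lookup ?s (\<alpha> + \<gamma>) = (\<Sum>\<delta> | a \<delta> \<noteq> 0. if \<delta> = \<gamma> then a \<delta> else 0)"
      unfolding lookup_sum by (intro sum.cong) (auto simp: lookup_witt_basis)
    also have "\<dots> = a \<gamma>"
      using assms by simp
    finally show ?thesis .
  qed
  have "x = ?s" if eq: "\<forall>\<gamma>. Poly_Mapping.lookup x (\<alpha> + \<gamma>) = a \<gamma>"
  proof (rule poly_mapping_eqI)
    fix \<delta>
    show "Poly_Mapping.lookup x \<delta> = Poly_Mapping.lookup ?s \<delta>"
      using spec[OF eq, of "\<delta> - \<alpha>"] s[of "\<delta> - \<alpha>"] by simp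
  qed
  with s show ?thesis
    by metis
qed

theorem proposition16:
  fixes f :: "'g::ab_group_add \<Rightarrow> complex"
  assumes "f 0 = 0"
    and "\<And>\<alpha> \<beta>. (f (\<alpha> + \<beta>) - f \<alpha> - f \<beta>) * (f \<alpha> - f \<beta>) = 0"
    and "infinite (range f) \<or> card (range f) \<ge> 4"
  shows "{\<phi>. half_derivation witt_scale (witt_bracket f) \<phi>} =
    {\<phi>. Vector_Spaces.linear witt_scale witt_scale \<phi> \<and>
      (\<exists>a :: 'g \<Rightarrow> complex. finite {\<gamma>. a \<gamma> \<noteq> 0} \<and>
        (\<forall>\<alpha>. \<phi> (witt_basis \<alpha>) = (\<Sum>\<gamma> | a \<gamma> \<noteq> 0. witt_scale (a \<gamma>) (witt_basis (\<alpha> + \<gamma>)))))}"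
proof (intro Collect_cong)
  fix \<phi> :: "('g \<Rightarrow>\<^sub>0 complex) \<Rightarrow> ('g \<Rightarrow>\<^sub>0 complex)"
  define c where "c \<alpha> \<gamma> = Poly_Mapping.lookup (\<phi> (witt_basis \<alpha>)) (\<alpha> + \<gamma>)" for \<alpha> \<gamma>
  have add: "f (\<alpha> + \<beta>) = f \<alpha> + f \<beta>" for \<alpha> \<beta>
    using additive_if_four_values[OF assms(2,3)] .
  let ?lin = "Vector_Spaces.linear witt_scale witt_scale \<phi>"
  have coeff: "half_derivation witt_scale (witt_bracket f) \<phi> \<longleftrightarrow>
    (\<forall>\<alpha> \<beta> \<gamma>. 2 * (f \<beta> - f \<alpha>) * c (\<alpha> + \<beta>) \<gamma> =
      (f \<beta> - f \<alpha> - f \<gamma>) * c \<alpha> \<gamma> + (f \<beta> + f \<gamma> - f \<alpha>) * c \<beta> \<gamma>)" if ?lin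
    using add that c_def by (rule half_derivation_iff_coeff)
  have "half_derivation witt_scale (witt_bracket f) \<phi> \<longleftrightarrow>
    ?lin \<and> (\<exists>a. finite {\<gamma>. a \<gamma> \<noteq> 0} \<and> (\<forall>\<alpha> \<gamma>. c \<alpha> \<gamma> = a \<gamma>))"
  proof (intro iffI conjI)
    assume D: "half_derivation witt_scale (witt_bracket f) \<phi>"
    then show ?lin
      by (simp add: half_derivation_def)
    have "c \<alpha> \<gamma> = c 0 \<gamma>" for \<alpha> \<gamma>
      using coeff[OF \<open>?lin\<close>] D
      by (intro coeff_constant[where c = "\<lambda>\<alpha>. c \<alpha> \<gamma>" and g = "f \<gamma>", OF add assms(3)]) blast
    moreover have "finite {\<gamma>. c 0 \<gamma> \<noteq> 0}"
      by (simp add: c_def)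
    ultimately show "\<exists>a. finite {\<gamma>. a \<gamma> \<noteq> 0} \<and> (\<forall>\<alpha> \<gamma>. c \<alpha> \<gamma> = a \<gamma>)"
      by blast
  next
    assume *: "?lin \<and> (\<exists>a. finite {\<gamma>. a \<gamma> \<noteq> 0} \<and> (\<forall>\<alpha> \<gamma>. c \<alpha> \<gamma> = a \<gamma>))"
    then obtain a where "\<And>\<alpha> \<gamma>. c \<alpha> \<gamma> = a \<gamma>"
      by blast
    with * show "half_derivation witt_scale (witt_bracket f) \<phi>"
      by (simp add: coeff algebra_simps)
  qed
  then show "half_derivation witt_scale (witt_bracket f) \<phi> \<longleftrightarrow>
    ?lin \<and> (\<exists>a. finite {\<gamma>. a \<gamma> \<noteq> 0} \<and>
      (\<forall>\<alpha>. \<phi> (witt_basis \<alpha>) = (\<Sum>\<gamma> | a \<gamma> \<noteq> 0. witt_scale (a \<gamma>) (witt_basis (\<alpha> + \<gamma>)))))"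
    by (simp add: shifted_sum_iff_lookup c_def cong: conj_cong)
qed

end
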